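(* Let $\mathbf{u}$ be a pseudostandard sequence starting with the letter $\mathtt{0}$, i.e. $\mathbf{u}=\mathbf{u}(\Delta,E^{\omega})$ for some $\Delta=\delta_1\delta_2\cdots\in\{\mathtt{0},\mathtt{1}\}^{\mathbb{N}}$ with $\delta_1=\mathtt{0}$, and let $v$ be a non-empty antipalindromic prefix of $\mathbf{u}$. For every letter $a\in\{\mathtt{0},\mathtt{1}\}$ occurring in $v$, denote $$e_a=\max\{|q| : q \text{ is an antipalindrome and } qa \text{ is a prefix of } v\},$$ and if no such prefix $qa$ exists, set $e_a=e_{\overline{a}}$. Then $\Gamma=\{e_{\mathtt{0}},\,e_{\mathtt{1}},\,|v|-e_{\mathtt{1}}-1\}$ is an attractor of $v$. Moreover, let $(w_n)_{n\ge 0}$ be the prefixes of $\mathbf{u}$ given by $w_0=\varepsilon$ and $w_{n+1}=(w_n\delta_{n+1})^{E}$. If $v=w_n$ with $n\geq 2$, then: (i) $\Gamma$ is of size two if and only if $\Delta$ starts with $\mathtt{0}^{n}$; (ii) $\Gamma$ is an attractor of $v$ of minimum size if and only if $\Delta$ does not start with $\mathtt{0}\mathtt{1}^{n-1}$.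
   Context: All words and sequences are over $\{\mathtt{0},\mathtt{1}\}$; $\varepsilon$ is the empty word, $|w|$ is the length of $w$, and positions in a word are indexed from $0$: $w=w_0w_1\cdots w_{|w|-1}$. Write $\overline{\mathtt 0}=\mathtt 1$, $\overline{\mathtt 1}=\mathtt 0$. The exchange antimorphism $E$ is $E(w_0w_1\cdots w_{n-1})=\overline{w_{n-1}}\cdots\overline{w_1}\,\overline{w_0}$. A word $w$ is an antipalindrome if $w=E(w)$ (in particular $\varepsilon$ is an antipalindrome). The antipalindromic closure $w^{E}$ of $w$ is the shortest antipalindrome having $w$ as a prefix. Given $\Delta=\delta_1\delta_2\cdots$ with $\delta_i\in\{\mathtt 0,\mathtt 1\}$, the pseudostandard sequence $\mathbf{u}(\Delta,E^{\omega})$ is the infinite sequence having as prefixes all the words $w_n$ defined by $w_0=\varepsilon$, $w_{n+1}=(w_n\delta_{n+1})^{E}$. An attractor (string attractor) of a word $w=w_0\cdots w_{n-1}$ is a set $\Gamma\subset\{0,1,\dots,n-1\}$ such that every non-empty factor of $w$ has an occurrence $w_iw_{i+1}\cdots w_{j-1}$ in $w$ with $\{i,i+1,\dots,j-1\}\cap\Gamma\neq\emptyset$. It is of minimum size if no attractor of $w$ has fewer elements. *)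

theory Defs
  imports Main "HOL-Library.Sublist"
begin

text \<open>Letters are booleans: \<open>False\<close> is the letter 0, \<open>True\<close> is the letter 1, and negation is the
  exchange of letters. Infinite sequences are functions on \<open>nat\<close>.\<close>

definition exchange :: "bool list \<Rightarrow> bool list" where
  "exchange w = rev (map Not w)"

definition antipalindrome :: "bool list \<Rightarrow> bool" where
  "antipalindrome w \<longleftrightarrow> w = exchange w"

definition antipal_closure :: "bool list \<Rightarrow> bool list" where
  "antipal_closure w = (ARG_MIN length x. antipalindrome x \<and> prefix w x)"

definition starts_with :: "(nat \<Rightarrow> 'a) \<Rightarrow> 'a list \<Rightarrow> bool" where
  "starts_with s w \<longleftrightarrow> map s [0..<length w] = w"

text \<open>Directive sequences are indexed from 0 here: \<open>\<Delta> n\<close> is the letter usually written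
  \<open>\<delta>\<close> with index \<open>n + 1\<close>.\<close>

fun pseudo_prefix :: "(nat \<Rightarrow> bool) \<Rightarrow> nat \<Rightarrow> bool list" where
  "pseudo_prefix \<Delta> 0 = []"
| "pseudo_prefix \<Delta> (Suc n) = antipal_closure (pseudo_prefix \<Delta> n @ [\<Delta> n])"

definition pseudostandard :: "(nat \<Rightarrow> bool) \<Rightarrow> (nat \<Rightarrow> bool)" where
  "pseudostandard \<Delta> = (THE u. \<forall>n. starts_with u (pseudo_prefix \<Delta> n))"

text \<open>The word occurring in \<open>w\<close> at positions \<open>i, \<dots>, j - 1\<close> is
  \<open>take (j - i) (drop i w)\<close>.\<close>

definition attractor :: "nat set \<Rightarrow> bool list \<Rightarrow> bool" where
  "attractor \<Gamma> w \<longleftrightarrow> \<Gamma> \<subseteq> {..<length w} \<and>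
     (\<forall>x. sublist x w \<and> x \<noteq> [] \<longrightarrow>
        (\<exists>i j. i \<le> j \<and> j \<le> length w \<and> x = take (j - i) (drop i w) \<and> {i..<j} \<inter> \<Gamma> \<noteq> {}))"

definition min_attractor :: "nat set \<Rightarrow> bool list \<Rightarrow> bool" where
  "min_attractor \<Gamma> w \<longleftrightarrow> attractor \<Gamma> w \<and> (\<forall>\<Gamma>'. attractor \<Gamma>' w \<longrightarrow> card \<Gamma> \<le> card \<Gamma>')"

definition ext_lengths :: "bool list \<Rightarrow> bool \<Rightarrow> nat set" where
  "ext_lengths v a = {length q | q. antipalindrome q \<and> prefix (q @ [a]) v}"

text \<open>A non-empty antipalindrome contains both letters, and \<open>q = []\<close> shows that
  \<open>ext_lengths v (hd v)\<close> is non-empty; so \<open>Max\<close> is only ever taken of non-empty (finite) sets.\<close>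

definition ext_length :: "bool list \<Rightarrow> bool \<Rightarrow> nat" where
  "ext_length v a =
     (if ext_lengths v a \<noteq> {} then Max (ext_lengths v a) else Max (ext_lengths v (\<not> a)))"

text \<open>The minimiser in \<open>antipal_closure\<close> and the sequence \<open>pseudostandard \<Delta>\<close> exist and are
  unique: \<open>antipal_closure_unique\<close>, \<open>pseudostandard_unique\<close>.\<close>

lemma exchange_exchange: "exchange (exchange w) = w"
  by (induction w) (auto simp: exchange_def)

lemma exchange_append: "exchange (v @ w) = exchange w @ exchange v"
  by (simp add: exchange_def)

lemma antipalindrome_append_exchange: "antipalindrome (w @ exchange w)"
  by (simp add: antipalindrome_def exchange_append exchange_exchange)

lemma antipalindrome_nth:
  assumes "antipalindrome x" "i < length x"
  shows "x ! i = (\<not> x ! (length x - 1 - i))"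
proof -
  have "x ! i = rev (map Not x) ! i"
    by (rule arg_cong[OF assms(1)[unfolded antipalindrome_def exchange_def], of "\<lambda>y. y ! i"])
  then show ?thesis
    using assms(2) by (simp add: rev_nth)
qed

lemma antipal_closure_unique:
  "\<exists>!x. is_arg_min length (\<lambda>x. antipalindrome x \<and> prefix w x) x"
proof -
  let ?P = "\<lambda>x. antipalindrome x \<and> prefix w x"
  have P0: "?P (w @ exchange w)"
    by (simp add: antipalindrome_append_exchange)
  have ex: "\<exists>x. is_arg_min length ?P x"
    using arg_min_nat_lemma[of ?P, OF P0] unfolding is_arg_min_linorder by blast
  have "x = y" if x: "is_arg_min length ?P x" and y: "is_arg_min length ?P y" for x y
  proof (rule nth_equalityI)
    have xP: "antipalindrome x" "prefix w x" and xmin: "\<And>z. ?P z \<Longrightarrow> length x \<le> length z"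
      using x unfolding is_arg_min_linorder by blast+
    have yP: "antipalindrome y" "prefix w y" and ymin: "\<And>z. ?P z \<Longrightarrow> length y \<le> length z"
      using y unfolding is_arg_min_linorder by blast+
    show len: "length x = length y"
      by (intro le_antisym xmin ymin conjI xP yP)
    have half: "length x \<le> 2 * length w"
      using xmin[OF P0] by (simp add: exchange_def)
    have pre: "x ! i = y ! i" if "i < length w" for i
      using xP(2) yP(2) that by (metis prefixE nth_append)
    fix i assume i: "i < length x"
    show "x ! i = y ! i"
    proof (cases "i < length w")
      case True
      then show ?thesis by (rule pre)
    next
      case False
      then have "length x - 1 - i < length w"
        using half i by linarith
      then show ?thesis
        using pre antipalindrome_nth[of x i] antipalindrome_nth[of y i] x y i len
        by (simp add: is_arg_min_linorder)
    qed
  qed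
  with ex show ?thesis by blast
qed

lemma antipal_closure_is_arg_min:
  "is_arg_min length (\<lambda>x. antipalindrome x \<and> prefix w x) (antipal_closure w)"
  unfolding antipal_closure_def arg_min_def
  by (rule someI_ex[OF ex1_implies_ex[OF antipal_closure_unique]])

lemma pseudo_prefix_Suc: "prefix (pseudo_prefix \<Delta> n @ [\<Delta> n]) (pseudo_prefix \<Delta> (Suc n))"
  using antipal_closure_is_arg_min[of "pseudo_prefix \<Delta> n @ [\<Delta> n]"]
  by (simp add: is_arg_min_linorder)

lemma pseudo_prefix_length: "n \<le> length (pseudo_prefix \<Delta> n)"
proof (induction n)
  case (Suc n)
  then show ?case
    using prefix_length_le[OF pseudo_prefix_Suc[of \<Delta> n]] by simp
qed simp

lemma pseudo_prefix_mono: "m \<le> n \<Longrightarrow> prefix (pseudo_prefix \<Delta> m) (pseudo_prefix \<Delta> n)"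
proof (induction n rule: dec_induct)
  case (step n)
  then show ?case
    using append_prefixD[OF pseudo_prefix_Suc[of \<Delta> n]] prefix_order.trans by blast
qed simp

lemma starts_with_iff: "starts_with s w \<longleftrightarrow> (\<forall>i<length w. s i = w ! i)"
  unfolding starts_with_def list_eq_iff_nth_eq[of "map s [0..<length w]" w] by simp

lemma pseudostandard_unique: "\<exists>!u. \<forall>n. starts_with u (pseudo_prefix \<Delta> n)"
proof -
  let ?w = "pseudo_prefix \<Delta>"
  define u where "u i = ?w (Suc i) ! i" for i
  have lt: "i < length (?w (Suc i))" for i
    using pseudo_prefix_length[of "Suc i" \<Delta>] by simp
  have agree: "?w m ! i = ?w n ! i" if "i < length (?w m)" "i < length (?w n)" for m n i
  proof (cases "m \<le> n")
    case True
    from pseudo_prefix_mono[OF this, of \<Delta>] obtain z where "?w n = ?w m @ z"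
      by (rule prefixE)
    then show ?thesis using that(1) that(2) by (simp only: nth_append if_True)
  next
    case False
    then have "n \<le> m" by simp
    from pseudo_prefix_mono[OF this, of \<Delta>] obtain z where "?w m = ?w n @ z"
      by (rule prefixE)
    then show ?thesis using that(1) that(2) by (simp only: nth_append if_True)
  qed
  have "\<forall>n. starts_with u (?w n)"
    unfolding starts_with_iff u_def by (intro allI impI agree lt)
  moreover have "s = u" if "\<forall>n. starts_with s (?w n)" for s
  proof
    fix i
    show "s i = u i"
      using that[rule_format, of "Suc i"] lt[of i] unfolding starts_with_iff u_def by blast
  qed
  ultimately show ?thesis by blast
qed

lemma pseudostandard_prefix: "starts_with (pseudostandard \<Delta>) (pseudo_prefix \<Delta> n)"
  unfolding pseudostandard_def by (rule theI'[OF pseudostandard_unique, rule_format])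

end

theory Submission
  imports Defs
begin

text \<open>Let \<open>q\<close> be the longest antipalindromic prefix of \<open>w\<^sub>n\<close> followed by the letter
  \<open>a = \<delta>\<^sub>n\<^sub>+\<^sub>1\<close>. Then \<open>w\<^sub>n\<^sub>+\<^sub>1 = w\<^sub>n q\<^sup>-\<^sup>1 w\<^sub>n\<close>, so a factor of \<open>w\<^sub>n\<^sub>+\<^sub>1\<close> avoiding position
  \<open>\<bar>w\<^sub>n\<bar>\<close> is a factor of \<open>w\<^sub>n\<close>, and position \<open>\<bar>q\<bar>\<close> of the second copy of \<open>w\<^sub>n\<close> is position \<open>\<bar>w\<^sub>n\<bar>\<close>
  of \<open>w\<^sub>n\<^sub>+\<^sub>1\<close>. The three positions of \<open>\<Gamma>\<close> for \<open>w\<^sub>n\<close>, read in the first or the second copy, thus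
  become those for \<open>w\<^sub>n\<^sub>+\<^sub>1\<close>. The only exception, at the first letter 1 of \<open>\<Delta>\<close>, where \<open>q\<close> does not
  exist, is \<open>w\<^sub>n = (01)\<^sup>n\<close> and \<open>w\<^sub>n\<^sub>+\<^sub>1 = w\<^sub>n 10 w\<^sub>n\<close>.

  Only two kinds of \<open>w\<^sub>n\<close> have an attractor of size two: if \<open>\<Delta>\<close> starts with \<open>0\<^sup>n\<close>, then
  \<open>e\<^sub>0 = e\<^sub>1\<close>, and if \<open>\<Delta>\<close> starts with \<open>01\<^sup>n\<^sup>-\<^sup>1\<close>, then the set \<open>{1, 3}\<close> works. In all other cases \<open>w\<^sub>n\<close> is the image under the Thue--Morse
  morphism of a word without factor 11, hence avoids 1101 and 0100, while 010, 101, 11 and 00 do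
  occur. Counting the factors of length two and three that meet two given positions shows that two
  positions do not suffice.\<close>

section \<open>Factors covering a position\<close>

text \<open>An occurrence is given by a factorization instead of by two indices, so that lengthening
  the word on either side only changes \<open>ys\<close> or \<open>zs\<close>.\<close>

definition covers :: "'a list \<Rightarrow> 'a list \<Rightarrow> nat \<Rightarrow> bool" where
  "covers w x k \<longleftrightarrow> (\<exists>ys zs. w = ys @ x @ zs \<and> length ys \<le> k \<and> k < length ys + length x)"

lemma coversI: "w = ys @ x @ zs \<Longrightarrow> length ys \<le> k \<Longrightarrow> k < length ys + length x \<Longrightarrow> covers w x k"
  unfolding covers_def by blast

lemma attractor_iff_covers:
  "attractor \<Gamma> w \<longleftrightarrow> \<Gamma> \<subseteq> {..<length w} \<and>
     (\<forall>x. sublist x w \<and> x \<noteq> [] \<longrightarrow> (\<exists>k\<in>\<Gamma>. covers w x k))"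
proof -
  have "(\<exists>i j. i \<le> j \<and> j \<le> length w \<and> x = take (j - i) (drop i w) \<and> {i..<j} \<inter> \<Gamma> \<noteq> {})
      \<longleftrightarrow> (\<exists>k\<in>\<Gamma>. covers w x k)" (is "?L = ?R") for x
  proof
    assume ?L
    then obtain i j k where ij: "i \<le> j" "j \<le> length w" "x = take (j - i) (drop i w)"
      and "{i..<j} \<inter> \<Gamma> \<noteq> {}"
      by blast
    then obtain k where k: "k \<in> \<Gamma>" "i \<le> k" "k < j" by fastforce
    have "w = take i w @ x @ drop (j - i) (drop i w)"
      unfolding ij(3) append_take_drop_id ..
    then have "covers w x k"
      by (rule coversI) (use ij k in auto)
    with k show ?R by blast
  next
    assume ?R
    then obtain k ys zs where k: "k \<in> \<Gamma>" "w = ys @ x @ zs" "length ys \<le> k" "k < length ys + length x"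
      unfolding covers_def by blast
    have "k \<in> {length ys..<length ys + length x} \<inter> \<Gamma>" using k by auto
    then show ?L
      using k by (intro exI[of _ "length ys"] exI[of _ "length ys + length x"]) auto
  qed
  then show ?thesis unfolding attractor_def by simp
qed

lemma covers_append_right: "covers w x k \<Longrightarrow> covers (w @ z) x k"
  unfolding covers_def by fastforce

lemma covers_append_left: "covers w x k \<Longrightarrow> covers (y @ w) x (length y + k)"
  unfolding covers_def by (metis add_le_cancel_left append.assoc length_append nat_add_left_cancel_less)

lemma covers_singleton: "k < length w \<Longrightarrow> covers w [w ! k] k"
  by (rule coversI[of _ "take k w" _ "drop (Suc k) w"]) (simp_all add: id_take_nth_drop[symmetric])

lemma covers_singleton_nth: "covers w [a] k \<Longrightarrow> w ! k = a"
  unfolding covers_def by (auto simp: less_Suc_eq_le dest: antisym)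

lemma sublist_cases_position:
  assumes "sublist x w" "k < length w"
  obtains "covers w x k" | "sublist x (take k w)" | "sublist x (drop (Suc k) w)"
proof -
  from assms obtain ys zs where w: "w = ys @ x @ zs" by (auto simp: sublist_def)
  consider "k < length ys" | "length ys \<le> k" "k < length ys + length x" | "length ys + length x \<le> k"
    by linarith
  then show ?thesis
  proof cases
    case 1
    then have "drop (Suc k) w = drop (Suc k) ys @ x @ zs" using w by simp
    then show ?thesis using that(3) by (auto simp: sublist_def)
  next
    case 2
    then show ?thesis using that(1) w by (auto simp: covers_def)
  next
    case 3
    then have "take k w = ys @ x @ take (k - length ys - length x) zs" using w by simp
    then show ?thesis using that(2) by (auto simp: sublist_def)
  qed
qed

text \<open>Here \<open>w\<close> is both a prefix and a suffix of \<open>v\<close>. The bounds on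
  \<open>k\<close> say that everything before \<open>k\<close> lies in the prefix copy and
  everything after \<open>k\<close> in the suffix copy.\<close>

lemma sublist_overlap_cases:
  assumes v: "v = w @ z" "v = y @ w" and x: "sublist x v"
    and k: "k \<le> length w" "length y \<le> Suc k" "k < length v"
  obtains "covers v x k" | "sublist x w"
  using x k(3)
proof (cases rule: sublist_cases_position)
  case 2
  have "take k v = take k w" using v(1) k(1) by simp
  with 2 that(2) show ?thesis by (metis sublist_take sublist_order.order.trans)
next
  case 3
  have "drop (Suc k) v = drop (Suc k - length y) w" using v(2) k(2) by simp
  with 3 that(2) show ?thesis by (metis sublist_drop sublist_order.order.trans)
qed (use that(1) in blast)

text \<open>Factors that miss \<open>k\<close> are factors of \<open>w\<close>, and the prefix copy
  of \<open>w\<close> covers them at unchanged positions.\<close>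

lemma attractor_overlap:
  assumes "attractor G w" "v = w @ z" "v = y @ w" "k \<in> G" "length y \<le> Suc k"
  shows "attractor G v"
  unfolding attractor_iff_covers
proof (intro conjI allI impI)
  have G: "G \<subseteq> {..<length w}" "\<And>x. sublist x w \<Longrightarrow> x \<noteq> [] \<Longrightarrow> \<exists>k\<in>G. covers w x k"
    using assms(1) unfolding attractor_iff_covers by auto
  then show "G \<subseteq> {..<length v}" using assms(2) by force
  fix x assume x: "sublist x v \<and> x \<noteq> []"
  have "k < length w" using G(1) assms(4) by auto
  then show "\<exists>k\<in>G. covers v x k"
    using sublist_overlap_cases[OF assms(2,3) conjunct1[OF x], of k] assms(4,5) G(2)[of x] x
    by (metis assms(2) covers_append_right length_append less_imp_le trans_less_add1)
qed

section \<open>Antipalindromes and pseudostandard words\<close>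

lemma length_exchange [simp]: "length (exchange w) = length w"
  by (simp add: exchange_def)

text \<open>A middle letter would equal its own complement.\<close>

lemma even_length_antipalindrome:
  assumes "antipalindrome w"
  shows "even (length w)"
proof (rule ccontr)
  assume "odd (length w)"
  then have "length w div 2 < length w" "length w - 1 - length w div 2 = length w div 2"
    by presburger+
  with antipalindrome_nth[OF assms, of "length w div 2"] show False by simp
qed

lemma sublist_exchange:
  assumes "antipalindrome v" "sublist x v"
  shows "sublist (exchange x) v"
proof -
  from assms(2) obtain ys zs where v: "v = ys @ x @ zs" by (auto simp: sublist_def)
  have "v = exchange v" using assms(1) by (simp add: antipalindrome_def)
  also have "\<dots> = exchange zs @ exchange x @ exchange ys" by (simp add: v exchange_append)
  finally show ?thesis by (auto simp: sublist_def)
qed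

section \<open>Closure of an antipalindrome followed by a letter\<close>

lemma antipal_closure_eqI:
  assumes "antipalindrome c" "prefix w c"
    and "\<And>z. antipalindrome z \<Longrightarrow> prefix w z \<Longrightarrow> length c \<le> length z"
  shows "antipal_closure w = c"
proof -
  have "is_arg_min length (\<lambda>x. antipalindrome x \<and> prefix w x) c"
    unfolding is_arg_min_linorder using assms by blast
  then show ?thesis using antipal_closure_unique antipal_closure_is_arg_min by blast
qed

lemma antipal_closure_props:
  "antipalindrome (antipal_closure w)" "prefix w (antipal_closure w)"
  "antipalindrome z \<Longrightarrow> prefix w z \<Longrightarrow> length (antipal_closure w) \<le> length z"
  using antipal_closure_is_arg_min[of w] unfolding is_arg_min_linorder by blast+

text \<open>By symmetry \<open>z\<close> also ends with \<open>w\<close>. As \<open>z\<close> is at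
  most twice as long as \<open>w\<close>, the two copies of \<open>w\<close> meet or overlap, and
  their overlap is \<open>q\<close>.\<close>

lemma antipalindrome_extension_overlap:
  assumes w: "antipalindrome w" and z: "antipalindrome z" "prefix (w @ [a]) z"
    and len: "length z \<le> 2 * length w"
  obtains q where "antipalindrome q" "prefix (q @ [a]) w" "length z = 2 * length w - length q"
proof -
  from z(2) obtain t' where t': "z = w @ a # t'" by (auto simp: prefix_def)
  define t where "t = a # t'"
  have zt: "z = w @ t" using t' t_def by simp
  have tw: "length t \<le> length w" using len zt by simp
  have "w @ t = exchange t @ w"
    using z(1) w unfolding zt antipalindrome_def by (simp add: exchange_append)
  then obtain q where q: "w = exchange t @ q" "w = q @ t"
    by (metis append_eq_append_conv_if append_eq_append_conv2 length_exchange tw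
        append_eq_conv_conj same_append_eq)
  have "exchange t @ exchange q = exchange t @ q"
    using w q unfolding antipalindrome_def by (metis exchange_append)
  then have "antipalindrome q" by (simp add: antipalindrome_def)
  moreover have "prefix (q @ [a]) w" using q(2) t_def by simp
  moreover have "length z = 2 * length w - length q"
    using zt arg_cong[OF q(2), of length] by simp
  ultimately show ?thesis by (rule that)
qed

text \<open>Any candidate of length at most \<open>2 * length w\<close> arises from an overlap, and
  the longest overlap gives the shortest word.\<close>

lemma antipal_closure_overlap:
  assumes w: "antipalindrome w" and q: "antipalindrome q" "prefix (q @ [a]) w"
    and max: "\<And>q'. antipalindrome q' \<Longrightarrow> prefix (q' @ [a]) w \<Longrightarrow> length q' \<le> length q"
  shows "antipal_closure (w @ [a]) = w @ drop (length q) w"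
proof (rule antipal_closure_eqI)
  from q(2) obtain r' where r': "w = q @ a # r'" by (auto simp: prefix_def)
  define r where "r = a # r'"
  have wr: "w = q @ r" using r' r_def by simp
  have "w = exchange r @ q"
    using w q(1) wr unfolding antipalindrome_def by (metis exchange_append)
  then have "w @ r = exchange r @ q @ r" by simp
  moreover have "exchange (exchange r @ q @ r) = exchange r @ q @ r"
    using q(1) by (simp add: exchange_append exchange_exchange antipalindrome_def)
  ultimately have "antipalindrome (w @ r)" by (simp add: antipalindrome_def)
  then show "antipalindrome (w @ drop (length q) w)"
    using wr by simp
  show "prefix (w @ [a]) (w @ drop (length q) w)" using wr r_def by simp
  fix z assume z: "antipalindrome z" "prefix (w @ [a]) z"
  show "length (w @ drop (length q) w) \<le> length z"
  proof (cases "length z \<le> 2 * length w")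
    case True
    from antipalindrome_extension_overlap[OF w z True] max show ?thesis
      by (metis diff_le_mono2 length_append length_drop mult_2 Nat.add_diff_assoc wr le_add1)
  qed simp
qed

text \<open>Without an overlap, a candidate is longer than \<open>2 * length w\<close>; since its
  length is even, at least two letters must be added.\<close>

lemma antipal_closure_no_overlap:
  assumes w: "antipalindrome w" and none: "\<And>q. antipalindrome q \<Longrightarrow> \<not> prefix (q @ [a]) w"
  shows "antipal_closure (w @ [a]) = w @ [a, \<not> a] @ w"
proof (rule antipal_closure_eqI)
  show "antipalindrome (w @ [a, \<not> a] @ w)"
    using w unfolding antipalindrome_def by (simp add: exchange_append) (simp add: exchange_def)
  show "prefix (w @ [a]) (w @ [a, \<not> a] @ w)" by simp
  fix z assume z: "antipalindrome z" "prefix (w @ [a]) z"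
  have "\<not> length z \<le> 2 * length w"
    using antipalindrome_extension_overlap[OF w z] none by blast
  moreover have "even (length z)" by (rule even_length_antipalindrome[OF z(1)])
  ultimately show "length (w @ [a, \<not> a] @ w) \<le> length z" by simp presburger
qed

section \<open>The words \<open>w\<^sub>n\<close> and the antipalindromic prefixes of the
  sequence\<close>

lemma antipalindrome_pseudo_prefix: "antipalindrome (pseudo_prefix \<Delta> n)"
proof (cases n)
  case 0
  then show ?thesis by (simp add: antipalindrome_def exchange_def)
qed (simp add: antipal_closure_props)

lemma length_pseudo_prefix_less: "i < j \<Longrightarrow> length (pseudo_prefix \<Delta> i) < length (pseudo_prefix \<Delta> j)"
proof (rule lift_Suc_mono_less[of "\<lambda>n. length (pseudo_prefix \<Delta> n)"])
  show "length (pseudo_prefix \<Delta> n) < length (pseudo_prefix \<Delta> (Suc n))" for n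
    using prefix_length_le[OF pseudo_prefix_Suc[of \<Delta> n]] by simp
qed

lemma prefix_pseudo_prefix_letter:
  "i < n \<Longrightarrow> prefix (pseudo_prefix \<Delta> i @ [\<Delta> i]) (pseudo_prefix \<Delta> n)"
  using prefix_order.trans[OF pseudo_prefix_Suc pseudo_prefix_mono] by simp

text \<open>An antipalindromic prefix of \<open>w\<^sub>n\<^sub>+\<^sub>1\<close> that is longer
  than \<open>w\<^sub>n\<close> competes in the closure defining
  \<open>w\<^sub>n\<^sub>+\<^sub>1\<close>, so it is the whole word.\<close>

lemma antipalindrome_prefix_pseudo_prefix:
  "antipalindrome z \<Longrightarrow> prefix z (pseudo_prefix \<Delta> n) \<Longrightarrow> \<exists>i\<le>n. z = pseudo_prefix \<Delta> i"
proof (induction n)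
  case 0
  then show ?case by simp
next
  case (Suc n)
  let ?w = "pseudo_prefix \<Delta> n" and ?v = "pseudo_prefix \<Delta> (Suc n)"
  note [simp del] = pseudo_prefix.simps(2)
  show ?case
  proof (cases "length z \<le> length ?w")
    case True
    have "prefix z ?w"
      using prefix_length_prefix[OF Suc.prems(2) pseudo_prefix_mono[of n "Suc n" \<Delta>]] True by simp
    from Suc.IH[OF Suc.prems(1) this] show ?thesis by (blast intro: le_SucI)
  next
    case False
    have "prefix (?w @ [\<Delta> n]) z"
      by (rule prefix_length_prefix[OF pseudo_prefix_Suc Suc.prems(2)]) (use False in simp)
    then have "length ?v \<le> length z"
      unfolding pseudo_prefix.simps by (rule antipal_closure_props(3)[OF Suc.prems(1)])
    moreover obtain t where "?v = z @ t" using Suc.prems(2) by (rule prefixE)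
    ultimately have "z = ?v" by simp
    then show ?thesis by blast
  qed
qed

lemma antipalindrome_prefix_pseudostandard:
  assumes "antipalindrome v" "starts_with (pseudostandard \<Delta>) v"
  obtains n where "v = pseudo_prefix \<Delta> n"
proof -
  let ?w = "pseudo_prefix \<Delta> (length v)"
  have len: "length v \<le> length ?w" by (rule pseudo_prefix_length)
  have "take (length v) ?w = v"
    using assms(2) pseudostandard_prefix[of \<Delta> "length v"] len
    unfolding starts_with_iff by (intro nth_equalityI) auto
  then have "prefix v ?w" by (metis take_is_prefix)
  from antipalindrome_prefix_pseudo_prefix[OF assms(1) this] that show ?thesis by blast
qed

text \<open>The antipalindromic proper prefixes are the earlier \<open>w\<^sub>i\<close>, each
  followed by \<open>\<Delta> i\<close>. This turns questions about \<open>e\<^sub>a\<close> into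
  questions about positions of \<open>a\<close> in \<open>\<Delta>\<close>.\<close>

lemma ext_lengths_pseudo_prefix:
  "ext_lengths (pseudo_prefix \<Delta> n) a = {length (pseudo_prefix \<Delta> i) | i. i < n \<and> \<Delta> i = a}"
proof (intro equalityI subsetI)
  fix l assume "l \<in> ext_lengths (pseudo_prefix \<Delta> n) a"
  then obtain q where q: "l = length q" "antipalindrome q" "prefix (q @ [a]) (pseudo_prefix \<Delta> n)"
    by (auto simp: ext_lengths_def)
  obtain i where i: "i \<le> n" "q = pseudo_prefix \<Delta> i"
    using antipalindrome_prefix_pseudo_prefix[OF q(2) append_prefixD[OF q(3)]] by blast
  have "i \<noteq> n" using prefix_length_le[OF q(3)] i by auto
  with i have "i < n" by simp
  have "prefix (q @ [a]) (q @ [\<Delta> i])"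
    using prefix_length_prefix[OF q(3) prefix_pseudo_prefix_letter[OF \<open>i < n\<close>, of \<Delta>]] i by simp
  then show "l \<in> {length (pseudo_prefix \<Delta> i) | i. i < n \<and> \<Delta> i = a}"
    using i q \<open>i < n\<close> by auto
next
  fix l assume "l \<in> {length (pseudo_prefix \<Delta> i) | i. i < n \<and> \<Delta> i = a}"
  then show "l \<in> ext_lengths (pseudo_prefix \<Delta> n) a"
    unfolding ext_lengths_def using antipalindrome_pseudo_prefix prefix_pseudo_prefix_letter by blast
qed

text \<open>A relation instead of a function, since \<open>a\<close> may be absent from the first
  \<open>n\<close> letters of \<open>\<Delta>\<close>.\<close>

definition last_index :: "(nat \<Rightarrow> bool) \<Rightarrow> bool \<Rightarrow> nat \<Rightarrow> nat \<Rightarrow> bool" where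
  "last_index \<Delta> a n i \<longleftrightarrow> i < n \<and> \<Delta> i = a \<and> (\<forall>j. i < j \<and> j < n \<longrightarrow> \<Delta> j \<noteq> a)"

lemma last_index_exists:
  assumes "i < n" "\<Delta> i = a"
  obtains j where "last_index \<Delta> a n j"
proof -
  let ?S = "{i. i < n \<and> \<Delta> i = a}"
  have fin: "finite ?S" "?S \<noteq> {}" using assms by auto
  have "j \<le> Max ?S" if "j < n" "\<Delta> j = a" for j
    using that by (intro Max_ge fin) simp
  moreover have "Max ?S \<in> ?S" by (rule Max_in[OF fin])
  ultimately have "last_index \<Delta> a n (Max ?S)"
    unfolding last_index_def by (force simp: not_less[symmetric])
  then show ?thesis by (rule that)
qed

lemma last_index_le: "last_index \<Delta> a n i \<Longrightarrow> j < n \<Longrightarrow> \<Delta> j = a \<Longrightarrow> j \<le> i"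
  unfolding last_index_def by (meson not_less)

lemma last_index_unique: "last_index \<Delta> a n i \<Longrightarrow> last_index \<Delta> a n j \<Longrightarrow> i = j"
  unfolding last_index_def by (meson linorder_neqE_nat)

lemma last_index_Suc: "last_index \<Delta> (\<Delta> n) (Suc n) n"
  by (auto simp: last_index_def)

lemma last_index_Suc_other: "last_index \<Delta> a n i \<Longrightarrow> \<Delta> n \<noteq> a \<Longrightarrow> last_index \<Delta> a (Suc n) i"
  unfolding last_index_def less_Suc_eq by blast

lemma ext_length_pseudo_prefix:
  assumes "last_index \<Delta> a n i"
  shows "ext_length (pseudo_prefix \<Delta> n) a = length (pseudo_prefix \<Delta> i)"
proof -
  let ?S = "{length (pseudo_prefix \<Delta> i) | i. i < n \<and> \<Delta> i = a}"
  have i: "i < n" "\<Delta> i = a" "\<And>j. j < n \<Longrightarrow> \<Delta> j = a \<Longrightarrow> j \<le> i"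
    using assms last_index_le[OF assms] by (simp_all add: last_index_def)
  have "?S = (\<lambda>i. length (pseudo_prefix \<Delta> i)) ` {i. i < n \<and> \<Delta> i = a}" by auto
  then have "finite ?S" by simp
  moreover have "length (pseudo_prefix \<Delta> i) \<in> ?S" using i by auto
  moreover have "l \<le> length (pseudo_prefix \<Delta> i)" if "l \<in> ?S" for l
    using that i(3) prefix_length_le[OF pseudo_prefix_mono[of _ i \<Delta>]] by auto
  ultimately have "Max ?S = length (pseudo_prefix \<Delta> i)" "?S \<noteq> {}"
    by (auto intro!: Max_eqI)
  then show ?thesis unfolding ext_length_def ext_lengths_pseudo_prefix by simp
qed

lemma ext_length_pseudo_prefix_none:
  assumes "\<And>i. i < n \<Longrightarrow> \<Delta> i \<noteq> a" "last_index \<Delta> (\<not> a) n i"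
  shows "ext_length (pseudo_prefix \<Delta> n) a = length (pseudo_prefix \<Delta> i)"
proof -
  have "ext_lengths (pseudo_prefix \<Delta> n) a = {}" "ext_lengths (pseudo_prefix \<Delta> n) (\<not> a) \<noteq> {}"
    using assms unfolding ext_lengths_pseudo_prefix last_index_def by auto
  then have "ext_length (pseudo_prefix \<Delta> n) a = ext_length (pseudo_prefix \<Delta> n) (\<not> a)"
    by (simp add: ext_length_def)
  with ext_length_pseudo_prefix[OF assms(2)] show ?thesis by simp
qed

section \<open>The recurrence from \<open>w\<^sub>n\<close> to
  \<open>w\<^sub>n\<^sub>+\<^sub>1\<close>\<close>

lemma pseudo_prefix_Suc_overlap:
  assumes "last_index \<Delta> (\<Delta> n) n i"
  shows "pseudo_prefix \<Delta> (Suc n) =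
    pseudo_prefix \<Delta> n @ drop (length (pseudo_prefix \<Delta> i)) (pseudo_prefix \<Delta> n)"
proof -
  have i: "i < n" "\<Delta> i = \<Delta> n" "\<And>j. j < n \<Longrightarrow> \<Delta> j = \<Delta> n \<Longrightarrow> j \<le> i"
    using assms last_index_le[OF assms] by (simp_all add: last_index_def)
  have "antipal_closure (pseudo_prefix \<Delta> n @ [\<Delta> n]) =
    pseudo_prefix \<Delta> n @ drop (length (pseudo_prefix \<Delta> i)) (pseudo_prefix \<Delta> n)"
  proof (rule antipal_closure_overlap)
    show "prefix (pseudo_prefix \<Delta> i @ [\<Delta> n]) (pseudo_prefix \<Delta> n)"
      using prefix_pseudo_prefix_letter[OF i(1), of \<Delta>] unfolding i(2) .
    fix q assume "antipalindrome q" "prefix (q @ [\<Delta> n]) (pseudo_prefix \<Delta> n)"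
    then have "length q \<in> ext_lengths (pseudo_prefix \<Delta> n) (\<Delta> n)"
      by (auto simp: ext_lengths_def)
    then show "length q \<le> length (pseudo_prefix \<Delta> i)"
      unfolding ext_lengths_pseudo_prefix
      using i(3) prefix_length_le[OF pseudo_prefix_mono[of _ i \<Delta>]] by auto
  qed (rule antipalindrome_pseudo_prefix)+
  then show ?thesis by simp
qed

text \<open>The suffix copy of \<open>w\<^sub>n\<close> starts at \<open>length y\<close>, so by the
  length equation its position \<open>\<bar>w\<^sub>i\<bar>\<close> is position
  \<open>\<bar>w\<^sub>n\<bar>\<close> of the new word.\<close>

lemma pseudo_prefix_Suc_period:
  assumes "last_index \<Delta> (\<Delta> n) n i"
  obtains y z where "pseudo_prefix \<Delta> (Suc n) = pseudo_prefix \<Delta> n @ z"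
    "pseudo_prefix \<Delta> (Suc n) = y @ pseudo_prefix \<Delta> n"
    "length (pseudo_prefix \<Delta> i) + length y = length (pseudo_prefix \<Delta> n)"
proof -
  let ?w = "pseudo_prefix \<Delta> n" and ?v = "pseudo_prefix \<Delta> (Suc n)"
  let ?z = "drop (length (pseudo_prefix \<Delta> i)) ?w"
  have v: "?v = ?w @ ?z" by (rule pseudo_prefix_Suc_overlap[OF assms])
  have "?v = exchange ?z @ ?w"
    using antipalindrome_pseudo_prefix[of \<Delta> "Suc n"] antipalindrome_pseudo_prefix[of \<Delta> n] v
    unfolding antipalindrome_def by (metis exchange_append)
  moreover have "length (pseudo_prefix \<Delta> i) < length ?w"
    using assms by (simp add: last_index_def length_pseudo_prefix_less)
  ultimately show ?thesis using v by (intro that[of ?z "exchange ?z"]) auto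
qed

lemma pseudo_prefix_Suc_no_overlap:
  assumes "\<And>i. i < n \<Longrightarrow> \<Delta> i \<noteq> \<Delta> n"
  shows "pseudo_prefix \<Delta> (Suc n) = pseudo_prefix \<Delta> n @ [\<Delta> n, \<not> \<Delta> n] @ pseudo_prefix \<Delta> n"
proof -
  have "ext_lengths (pseudo_prefix \<Delta> n) (\<Delta> n) = {}"
    using assms unfolding ext_lengths_pseudo_prefix by auto
  then have "\<not> prefix (q @ [\<Delta> n]) (pseudo_prefix \<Delta> n)" if "antipalindrome q" for q
    using that by (auto simp: ext_lengths_def)
  then show ?thesis
    by (simp add: antipal_closure_no_overlap[OF antipalindrome_pseudo_prefix])
qed

lemma pseudo_prefix_1: "pseudo_prefix \<Delta> (Suc 0) = [\<Delta> 0, \<not> \<Delta> 0]"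
  using pseudo_prefix_Suc_no_overlap[of 0 \<Delta>] by simp

declare pseudo_prefix.simps(2) [simp del]

lemma pseudo_prefix_nth_1:
  assumes "0 < n"
  shows "pseudo_prefix \<Delta> n ! 1 = (\<not> \<Delta> 0)"
  using pseudo_prefix_mono[of "Suc 0" n \<Delta>] assms unfolding pseudo_prefix_1 by (auto simp: prefix_def)

section \<open>The attractor\<close>

text \<open>Each closure shifts by the same amount as the one before it, and the first shift is
  2.\<close>

lemma length_pseudo_prefix_zeros:
  "(\<And>i. i < n \<Longrightarrow> \<not> \<Delta> i) \<Longrightarrow> length (pseudo_prefix \<Delta> n) = 2 * n"
proof (induction n rule: less_induct)
  case (less n)
  consider "n = 0" | "n = Suc 0" | m where "n = Suc (Suc m)" by (metis not0_implies_Suc)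
  then show ?case
  proof cases
    case 3
    then have "last_index \<Delta> (\<Delta> (Suc m)) (Suc m) m" using less.prems by (auto simp: last_index_def)
    then obtain y z where "pseudo_prefix \<Delta> n = y @ pseudo_prefix \<Delta> (Suc m)"
      "length (pseudo_prefix \<Delta> m) + length y = length (pseudo_prefix \<Delta> (Suc m))"
      unfolding 3 by (rule pseudo_prefix_Suc_period)
    moreover have "length (pseudo_prefix \<Delta> m) = 2 * m" "length (pseudo_prefix \<Delta> (Suc m)) = 2 * Suc m"
      using less 3 by simp_all
    ultimately show ?thesis using 3 by simp
  qed (use pseudo_prefix_1[of \<Delta>] in simp_all)
qed

text \<open>The word is \<open>(01)^(n+1)\<close> and \<open>2 * n\<close> is the position of its
  last 0. The suffix copy is shifted by 2, which moves the last 0 of one word to the last 0 of the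
  next.\<close>

lemma covers_pseudo_prefix_zeros:
  assumes "\<And>i. i < Suc n \<Longrightarrow> \<not> \<Delta> i" "sublist x (pseudo_prefix \<Delta> (Suc n))" "x \<noteq> []"
  shows "covers (pseudo_prefix \<Delta> (Suc n)) x (2 * n) \<or> x = [True]"
  using assms
proof (induction n)
  case 0
  have w: "pseudo_prefix \<Delta> (Suc 0) = [False, True]"
    using 0(1) pseudo_prefix_1[of \<Delta>] by simp
  have "0 < length (pseudo_prefix \<Delta> (Suc 0))" unfolding w by simp
  with 0(2) show ?case
  proof (cases rule: sublist_cases_position)
    case 3
    then have "sublist x [True]" unfolding w by simp
    with 0(3) show ?thesis by (auto simp: sublist_Cons_right prefix_Cons)
  qed (use 0(3) in simp_all)
next
  case (Suc n)
  let ?w = "pseudo_prefix \<Delta> (Suc n)" and ?v = "pseudo_prefix \<Delta> (Suc (Suc n))"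
  have len: "length (pseudo_prefix \<Delta> n) = 2 * n" "length ?w = 2 * Suc n" "length ?v = 2 * Suc (Suc n)"
    using Suc.prems(1) by (simp_all add: length_pseudo_prefix_zeros)
  have "last_index \<Delta> (\<Delta> (Suc n)) (Suc n) n" using Suc.prems by (auto simp: last_index_def)
  then obtain y z where yz: "?v = ?w @ z" "?v = y @ ?w"
    "length (pseudo_prefix \<Delta> n) + length y = length ?w"
    by (rule pseudo_prefix_Suc_period)
  have y: "length y = 2" using yz(3) len by simp
  show ?case
  proof (rule sublist_overlap_cases[OF yz(1,2) Suc.prems(2), of "2 * Suc n"])
    assume "sublist x ?w"
    then have "covers ?w x (2 * n) \<or> x = [True]"
      using Suc.IH Suc.prems(1,3) by (metis less_SucI)
    then show ?thesis
      using covers_append_left[of ?w x "2 * n" y] y yz(2) by auto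
  qed (use y len in simp_all)
qed

text \<open>Induction on \<open>n\<close>: each closure makes \<open>\<bar>w\<^sub>n\<bar>\<close>
  the new value of \<open>e\<^sub>0\<close> or \<open>e\<^sub>1\<close>, and every old position
  becomes a new one when read in a suitable copy of \<open>w\<^sub>n\<close>. The third position is
  the mirror image of \<open>e\<^sub>1\<close>.\<close>

lemma covers_pseudo_prefix:
  assumes "\<not> \<Delta> 0" "last_index \<Delta> False n i" "last_index \<Delta> True n j"
    and "sublist x (pseudo_prefix \<Delta> n)" "x \<noteq> []"
  shows "\<exists>k \<in> {length (pseudo_prefix \<Delta> i), length (pseudo_prefix \<Delta> j),
    length (pseudo_prefix \<Delta> n) - length (pseudo_prefix \<Delta> j) - 1}. covers (pseudo_prefix \<Delta> n) x k"
  using assms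
proof (induction n arbitrary: i j)
  case 0
  then show ?case by (simp add: last_index_def)
next
  case (Suc n)
  let ?l = "\<lambda>i. length (pseudo_prefix \<Delta> i)"
  let ?w = "pseudo_prefix \<Delta> n" and ?v = "pseudo_prefix \<Delta> (Suc n)"
  have n: "0 < n"
    using Suc.prems(1,3) by (cases n) (auto simp: last_index_def)
  have lt: "?l n < ?l (Suc n)" by (simp add: length_pseudo_prefix_less)
  show ?case
  proof (cases "\<exists>m<n. \<Delta> m")
    case True
    then obtain j' where j': "last_index \<Delta> True n j'" using last_index_exists by metis
    obtain i' where i': "last_index \<Delta> False n i'"
      using last_index_exists[of 0 n \<Delta> False] n Suc.prems(1) by blast
    have IH: "\<exists>k \<in> {?l i', ?l j', ?l n - ?l j' - 1}. covers ?w x k" if "sublist x ?w"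
      using Suc.IH[OF Suc.prems(1) i' j' that Suc.prems(5)] .
    have less: "?l i' < ?l n" "?l j' < ?l n"
      using i' j' by (simp_all add: last_index_def length_pseudo_prefix_less)
    show ?thesis
    proof (cases "\<Delta> n")
      case False
      have ij: "i = n" "j = j'"
        using Suc.prems(2,3) last_index_Suc[of \<Delta> n] last_index_Suc_other[OF j'] False
        by (simp_all add: last_index_unique)
      obtain y z where yz: "?v = ?w @ z" "?v = y @ ?w" "?l i' + length y = ?l n"
        using pseudo_prefix_Suc_period[of \<Delta> n i'] i' False by (metis (full_types))
      show ?thesis
      proof (rule sublist_overlap_cases[OF yz(1,2) Suc.prems(4), of "?l n"])
        assume "sublist x ?w"
        from IH[OF this] obtain k where k: "k \<in> {?l i', ?l j', ?l n - ?l j' - 1}" "covers ?w x k" ..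
        have "covers ?v x k" "covers ?v x (length y + k)"
          using covers_append_left[OF k(2), of y] covers_append_right[OF k(2), of z] yz by simp_all
        \<comment> \<open>The old \<open>e\<^sub>0\<close> and the mirror image of
          \<open>e\<^sub>1\<close> are read in the suffix copy, \<open>e\<^sub>1\<close> in the
          prefix copy.\<close>
        moreover have "length y + ?l i' = ?l n" "length y + (?l n - ?l j' - 1) = ?l (Suc n) - ?l j' - 1"
          using yz(2,3) less by simp_all
        ultimately show ?thesis using k(1) unfolding ij by (elim insertE) simp_all
      qed (use yz(3) lt ij in simp_all)
    next
      case True
      have ij: "i = i'" "j = n"
        using Suc.prems(2,3) last_index_Suc[of \<Delta> n] last_index_Suc_other[OF i'] True
        by (simp_all add: last_index_unique)
      obtain y z where yz: "?v = ?w @ z" "?v = y @ ?w" "?l j' + length y = ?l n"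
        using pseudo_prefix_Suc_period[of \<Delta> n j'] j' True by (metis (full_types))
      show ?thesis
      proof (rule sublist_overlap_cases[OF yz(1,2) Suc.prems(4), of "?l n"])
        assume "sublist x ?w"
        from IH[OF this] obtain k where k: "k \<in> {?l i', ?l j', ?l n - ?l j' - 1}" "covers ?w x k" ..
        have "covers ?v x k" "covers ?v x (length y + k)"
          using covers_append_left[OF k(2), of y] covers_append_right[OF k(2), of z] yz by simp_all
        \<comment> \<open>Now the old \<open>e\<^sub>1\<close> is read in the suffix copy. The old
          mirror position, read in the prefix copy, is the mirror image of the new
          \<open>e\<^sub>1\<close>.\<close>
        moreover have "?l n - ?l j' - 1 = ?l (Suc n) - ?l n - 1" "length y + ?l j' = ?l n"
          using yz(2,3) by simp_all
        ultimately show ?thesis using k(1) unfolding ij by (elim insertE) simp_all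
      qed (use yz(3) lt ij in simp_all)
    qed
  next
    case False
    then have zero: "\<not> \<Delta> m" if "m < n" for m using that by blast
    have \<Delta>n: "\<Delta> n" using Suc.prems(3) zero unfolding last_index_def less_Suc_eq by blast
    have "\<not> \<Delta> (n - 1)" using zero n by simp
    then have "last_index \<Delta> False n (n - 1)" unfolding last_index_def using n by fastforce
    then have ij: "i = n - 1" "j = n"
      using Suc.prems(2,3) last_index_Suc[of \<Delta> n] last_index_Suc_other[of \<Delta> False n "n - 1"] \<Delta>n
      by (simp_all add: last_index_unique)
    have len: "?l i = 2 * (n - 1)" "?l n = 2 * n"
      using zero ij by (simp_all add: length_pseudo_prefix_zeros)
    have v: "?v = ?w @ [True, False] @ ?w"
      using pseudo_prefix_Suc_no_overlap[of n \<Delta>] zero \<Delta>n by simp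
    \<comment> \<open>The positions \<open>e\<^sub>1\<close> and its mirror image are the two
      letters inserted between the copies of \<open>w\<^sub>n\<close>.\<close>
    have pos: "?l (Suc n) - ?l n - 1 = Suc (?l n)" unfolding v using n len by simp
    have in_w: ?thesis if "sublist x ?w"
    proof -
      from covers_pseudo_prefix_zeros[of "n - 1" \<Delta> x] that zero n Suc.prems(5)
      have "covers ?w x (?l i) \<or> x = [True]" unfolding len by simp
      \<comment> \<open>The single letter 1, left out by the all-zero case, is the first inserted
        letter.\<close>
      moreover have "covers ?v [True] (?l n)"
        using covers_singleton[OF lt] by (simp add: v nth_append)
      moreover have "covers ?w x (?l i) \<Longrightarrow> covers ?v x (?l i)"
        unfolding v by (rule covers_append_right)
      ultimately have "covers ?v x (?l i) \<or> covers ?v x (?l j)" unfolding ij(2) by blast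
      then show ?thesis by blast
    qed
    from Suc.prems(4) lt show ?thesis
    proof (cases rule: sublist_cases_position)
      case 1
      with ij show ?thesis by blast
    next
      case 2
      then show ?thesis using in_w v by simp
    next
      case 3
      then have "sublist x ([False] @ ?w)" unfolding v by simp
      moreover have "0 < length ([False] @ ?w)" by simp
      ultimately show ?thesis
      proof (cases rule: sublist_cases_position)
        case 1
        then have "covers ?v x (Suc (?l n))"
          using covers_append_left[of "[False] @ ?w" x 0 "?w @ [True]"] v by simp
        then show ?thesis using pos ij by auto
      next
        case 2
        then show ?thesis using Suc.prems(5) by simp
      next
        case 3
        then show ?thesis using in_w by simp
      qed
    qed
  qed
qed

section \<open>Lower bounds for attractors\<close>

text \<open>The offset is an integer and the predicate is false outside the word, so windows
  reaching over either end need no separate treatment.\<close>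

definition letter :: "'a list \<Rightarrow> nat \<Rightarrow> int \<Rightarrow> 'a \<Rightarrow> bool" where
  "letter v k d a \<longleftrightarrow> (\<exists>i<length v. int i = int k + d \<and> v ! i = a)"

lemma letter_append:
  "i < length x \<Longrightarrow> int (length ys) + int i = int k + d \<Longrightarrow> letter (ys @ x @ zs) k d (x ! i)"
  unfolding letter_def by (rule exI[of _ "length ys + i"]) (simp add: nth_append)

lemma letter_unique: "letter v k d a \<Longrightarrow> letter v k d b \<Longrightarrow> a = b"
  unfolding letter_def by (metis of_nat_eq_iff)

lemma covers_letters2:
  assumes "covers v [a, b] k"
  shows "letter v k (- 1) a \<and> letter v k 0 b \<or> letter v k 0 a \<and> letter v k 1 b"
proof -
  from assms obtain ys zs where v: "v = ys @ [a, b] @ zs" "length ys \<le> k" "k < length ys + 2"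
    by (auto simp: covers_def)
  have l: "letter v k d a" "letter v k (d + 1) b" if "int (length ys) = int k + d" for d
    using letter_append[of 0 "[a, b]" ys k d zs] letter_append[of 1 "[a, b]" ys k "d + 1" zs] that v(1)
    by simp_all
  from v(2,3) consider "int (length ys) = int k + - 1" | "int (length ys) = int k + 0" by fastforce
  then show ?thesis
  proof cases
    case 1
    from l[OF this] show ?thesis by simp
  next
    case 2
    from l[OF this] show ?thesis by simp
  qed
qed

lemma covers_letters3:
  assumes "covers v [a, b, c] k"
  shows "letter v k (- 2) a \<and> letter v k (- 1) b \<and> letter v k 0 c \<or>
    letter v k (- 1) a \<and> letter v k 0 b \<and> letter v k 1 c \<or>
    letter v k 0 a \<and> letter v k 1 b \<and> letter v k 2 c"
proof -
  from assms obtain ys zs where v: "v = ys @ [a, b, c] @ zs" "length ys \<le> k" "k < length ys + 3"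
    by (auto simp: covers_def)
  have l: "letter v k d a" "letter v k (d + 1) b" "letter v k (d + 2) c"
    if "int (length ys) = int k + d" for d
    using letter_append[of 0 "[a, b, c]" ys k d zs] letter_append[of 1 "[a, b, c]" ys k "d + 1" zs]
      letter_append[of 2 "[a, b, c]" ys k "d + 2" zs] that v(1)
    by simp_all
  from v(2,3) consider "int (length ys) = int k + - 2" | "int (length ys) = int k + - 1"
    | "int (length ys) = int k + 0"
    by fastforce
  then show ?thesis
  proof cases
    case 1
    from l[OF this] show ?thesis by simp
  next
    case 2
    from l[OF this] show ?thesis by simp
  next
    case 3
    from l[OF this] show ?thesis by simp
  qed
qed

lemma sublist_lettersI:
  assumes "x \<noteq> []" "\<And>i. i < length x \<Longrightarrow> letter v k (d + int i) (x ! i)"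
  shows "sublist x v"
proof -
  define m where "m = nat (int k + d)"
  have m: "0 \<le> int k + d" using assms(2)[of 0] assms(1) by (auto simp: letter_def)
  have x: "m + i < length v \<and> v ! (m + i) = x ! i" if i: "i < length x" for i
  proof -
    obtain j where j: "j < length v" "int j = int k + (d + int i)" "v ! j = x ! i"
      using assms(2)[OF i] by (auto simp: letter_def)
    then have "j = m + i" using m by (simp add: m_def)
    with j show ?thesis by simp
  qed
  have "m + (length x - 1) < length v" using x[of "length x - 1"] assms(1) by simp
  then have "take (length x) (drop m v) = x"
    using x by (intro nth_equalityI) auto
  then show ?thesis by (metis sublist_drop sublist_order.order.trans sublist_take)
qed

text \<open>The predicates stand for the letters at offsets -1, 0, 1 from the two positions, which
  leaves a purely propositional problem. The pairs 01 and 10 cannot both belong to one position,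
  because 00 and 11 share no middle letter.\<close>

lemma four_pairs_in_two_windows:
  fixes p q r p' q' r' :: "bool \<Rightarrow> bool"
  assumes "(p False \<and> q True \<or> q False \<and> r True) \<or> (p' False \<and> q' True \<or> q' False \<and> r' True)"
    "(p True \<and> q False \<or> q True \<and> r False) \<or> (p' True \<and> q' False \<or> q' True \<and> r' False)"
    "(p True \<and> q True \<or> q True \<and> r True) \<or> (p' True \<and> q' True \<or> q' True \<and> r' True)"
    "(p False \<and> q False \<or> q False \<and> r False) \<or> (p' False \<and> q' False \<or> q' False \<and> r' False)"
    and "\<not> (p True \<and> p False)" "\<not> (q True \<and> q False)" "\<not> (r True \<and> r False)"
    "\<not> (p' True \<and> p' False)" "\<not> (q' True \<and> q' False)" "\<not> (r' True \<and> r' False)"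
  shows "p False \<and> q False \<and> r True \<and> p' True \<and> q' True \<and> r' False \<or>
    p True \<and> q True \<and> r False \<and> p' False \<and> q' False \<and> r' True \<or>
    p False \<and> q True \<and> r True \<and> p' True \<and> q' False \<and> r' False \<or>
    p True \<and> q False \<and> r False \<and> p' False \<and> q' True \<and> r' True"
  using assms by argo

text \<open>In each way of covering the words of length two, covering 101 or 010 as well forces a
  forbidden word of length four.\<close>

lemma no_two_element_attractor:
  assumes att: "attractor {g, h} v"
    and occ: "sublist [False, True, False] v" "sublist [True, False, True] v"
      "sublist [True, True] v" "sublist [False, False] v"
    and avoid: "\<not> sublist [True, True, False, True] v" "\<not> sublist [False, True, False, False] v"
  shows False
proof -
  have "sublist [a, b] v" if "sublist [a, b, c] v" for a b c
    using sublist_order.order.trans[OF sublist_appendI[of "[a, b]" "[]" "[c]"]] that by simp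
  then have occ2: "sublist [False, True] v" "sublist [True, False] v"
    using occ(1,2) by blast+
  have cover: "covers v x g \<or> covers v x h" if "sublist x v" "x \<noteq> []" for x
    using att that unfolding attractor_iff_covers by auto
  have "(letter v g (- 1) a \<and> letter v g 0 b \<or> letter v g 0 a \<and> letter v g 1 b) \<or>
      (letter v h (- 1) a \<and> letter v h 0 b \<or> letter v h 0 a \<and> letter v h 1 b)"
    if "sublist [a, b] v" for a b
    by (rule disj_forward[OF cover[OF that list.distinct(2)] covers_letters2 covers_letters2])
  note two = this[OF occ2(1)] this[OF occ2(2)] this[OF occ(3)] this[OF occ(4)]
  have "(letter v g (- 2) a \<and> letter v g (- 1) b \<and> letter v g 0 c \<or>
      letter v g (- 1) a \<and> letter v g 0 b \<and> letter v g 1 c \<or>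
      letter v g 0 a \<and> letter v g 1 b \<and> letter v g 2 c) \<or>
      (letter v h (- 2) a \<and> letter v h (- 1) b \<and> letter v h 0 c \<or>
      letter v h (- 1) a \<and> letter v h 0 b \<and> letter v h 1 c \<or>
      letter v h 0 a \<and> letter v h 1 b \<and> letter v h 2 c)"
    if "sublist [a, b, c] v" for a b c
    by (rule disj_forward[OF cover[OF that list.distinct(2)] covers_letters3 covers_letters3])
  note three = this[OF occ(1)] this[OF occ(2)]
  have unique: "\<not> (letter v k d True \<and> letter v k d False)" for k d
    using letter_unique by fastforce
  have same: "letter v k d b \<longleftrightarrow> b = a" if "letter v k d a" for k d a b
    using letter_unique that by fast
  \<comment> \<open>Both forbidden words have the form \<open>a10a\<close>: 1101 for
    \<open>a = True\<close> and 0100 for \<open>a = False\<close>.\<close>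
  have avoid4: "\<not> (letter v k d a \<and> letter v k (d + 1) True \<and> letter v k (d + 2) False \<and>
      letter v k (d + 3) a)" for k d a
  proof
    assume "letter v k d a \<and> letter v k (d + 1) True \<and> letter v k (d + 2) False \<and> letter v k (d + 3) a"
    then have "sublist [a, True, False, a] v"
      by (intro sublist_lettersI[of _ v k d]) (auto simp: less_Suc_eq numeral_eq_Suc)
    with avoid show False by (cases a) simp_all
  qed
  have no_1101: "\<not> (letter v k (- 1) True \<and> letter v k 0 True \<and> letter v k 1 False \<and> letter v k 2 True)" for k
    using avoid4[of k "- 1" True] by simp
  have no_0100: "\<not> (letter v k (- 2) False \<and> letter v k (- 1) True \<and> letter v k 0 False \<and> letter v k 1 False)" for k
    using avoid4[of k "- 2" False] by simp
  \<comment> \<open>Only four windows of length two meet \<open>{g, h}\<close>, so each of the four words of length two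
    occupies exactly one of them; this leaves four possibilities for the letters around \<open>g\<close> and \<open>h\<close>.\<close>
  consider
    "letter v g (- 1) False" "letter v g 0 False" "letter v g 1 True"
      "letter v h (- 1) True" "letter v h 0 True" "letter v h 1 False"
  | "letter v g (- 1) True" "letter v g 0 True" "letter v g 1 False"
      "letter v h (- 1) False" "letter v h 0 False" "letter v h 1 True"
  | "letter v g (- 1) False" "letter v g 0 True" "letter v g 1 True"
      "letter v h (- 1) True" "letter v h 0 False" "letter v h 1 False"
  | "letter v g (- 1) True" "letter v g 0 False" "letter v g 1 False"
      "letter v h (- 1) False" "letter v h 0 True" "letter v h 1 True"
    using four_pairs_in_two_windows[OF two unique unique unique unique unique unique] by blast
  then show False
  proof cases
    case 1
    \<comment> \<open>The letters around the two positions are 001 and 110. Only the window starting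
      at \<open>h\<close> can hold 101, and the 1 before it would complete 1101.\<close>
    then show False
      using three(2) no_1101[of h] by (simp add: 1[THEN same])
  next
    case 2
    then show False
      using three(2) no_1101[of g] by (simp add: 2[THEN same])
  next
    \<comment> \<open>The letters are 011 and 100. Only the window ending at \<open>h\<close> can
      hold 010, and the 0 after it would complete 0100.\<close>
    case 3
    then show False
      using three(1) no_0100[of h] by (simp add: 3[THEN same])
  next
    case 4
    then show False
      using three(1) no_0100[of g] by (simp add: 4[THEN same])
  qed
qed

lemma attractor_hits_letter: "attractor G v \<Longrightarrow> a \<in> set v \<Longrightarrow> \<exists>k\<in>G. v ! k = a"
  unfolding attractor_iff_covers
  by (metis covers_singleton_nth in_set_conv_decomp list.distinct(1) sublist_appendI append_Cons append_Nil)

lemma attractor_card_ge_2: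
  assumes "attractor G v" "True \<in> set v" "False \<in> set v"
  shows "2 \<le> card G"
proof -
  obtain k l where kl: "k \<in> G" "l \<in> G" "v ! k" "\<not> v ! l"
    using attractor_hits_letter[OF assms(1,2)] attractor_hits_letter[OF assms(1,3)] by blast
  have "finite G" using assms(1) finite_subset unfolding attractor_def by blast
  then have "card {k, l} \<le> card G" using kl by (intro card_mono) auto
  moreover have "k \<noteq> l" using kl by blast
  ultimately show ?thesis by simp
qed

lemma attractor_card_ge_3:
  assumes att: "attractor G v"
    and occ: "sublist [False, True, False] v" "sublist [True, False, True] v"
      "sublist [True, True] v" "sublist [False, False] v"
    and avoid: "\<not> sublist [True, True, False, True] v" "\<not> sublist [False, True, False, False] v"
  shows "3 \<le> card G"
proof (rule ccontr)
  assume "\<not> 3 \<le> card G"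
  moreover have "2 \<le> card G"
    using set_mono_sublist[OF occ(1)] by (intro attractor_card_ge_2[OF att]) auto
  ultimately have "card G = 2" by simp
  then obtain g h where "G = {g, h}" by (meson card_2_iff)
  with no_two_element_attractor[of g h v] assms show False by blast
qed

section \<open>Pseudostandard words as Thue--Morse images\<close>

fun morse :: "bool list \<Rightarrow> bool list" where
  "morse [] = []"
| "morse (a # s) = a # (\<not> a) # morse s"

lemma morse_append: "morse (s @ t) = morse s @ morse t"
  by (induction s) simp_all

lemma length_morse: "length (morse s) = 2 * length s"
  by (induction s) simp_all

lemma drop_morse: "drop (2 * k) (morse s) = morse (drop k s)"
proof (induction s arbitrary: k)
  case (Cons a s)
  then show ?case by (cases k) simp_all
qed simp

text \<open>The pairs 11 and 00 must straddle two blocks. Hence 1101 forces the blocks 01, 10, 10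
  and 0100 forces 10, 10, 01; either way the preimage contains 11.\<close>

lemma morse_avoids:
  "successively (\<lambda>a b. \<not> (a \<and> b)) s \<Longrightarrow>
    \<not> sublist [True, True, False, True] (morse s) \<and> \<not> sublist [False, True, False, False] (morse s)"
proof (induction s rule: induct_list012)
  case (3 x y zs)
  then show ?case by (cases zs) (auto simp: sublist_Cons_right)
qed (auto simp: sublist_Cons_right)

text \<open>Overlaps have even length, so the recurrence lifts to the preimage \<open>s\<close>.
  That \<open>s\<close> begins and ends with 0 keeps 11 from arising at the junctions.\<close>

lemma pseudo_prefix_morse:
  assumes "\<not> \<Delta> 0"
  shows "\<exists>s. pseudo_prefix \<Delta> (Suc n) = morse s \<and> s \<noteq> [] \<and> \<not> hd s \<and> \<not> last s \<and>
    successively (\<lambda>a b. \<not> (a \<and> b)) s"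
proof (induction n)
  case 0
  show ?case using assms pseudo_prefix_1[of \<Delta>] by (intro exI[of _ "[False]"]) simp
next
  case (Suc n)
  then obtain s where s: "pseudo_prefix \<Delta> (Suc n) = morse s" "s \<noteq> []" "\<not> hd s" "\<not> last s"
    "successively (\<lambda>a b. \<not> (a \<and> b)) s" by blast
  show ?case
  proof (cases "\<exists>i. last_index \<Delta> (\<Delta> (Suc n)) (Suc n) i")
    case True
    then obtain i where i: "last_index \<Delta> (\<Delta> (Suc n)) (Suc n) i" by blast
    obtain k where k: "length (pseudo_prefix \<Delta> i) = 2 * k"
      using even_length_antipalindrome[OF antipalindrome_pseudo_prefix] by blast
    have "length (pseudo_prefix \<Delta> i) < length (pseudo_prefix \<Delta> (Suc n))"
      using i by (simp add: last_index_def length_pseudo_prefix_less)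
    then have ks: "k < length s" unfolding k s(1) length_morse by simp
    have d: "successively (\<lambda>a b. \<not> (a \<and> b)) (drop k s)"
      using s(5) successively_append_iff[of _ "take k s" "drop k s"] by simp
    show ?thesis
    proof (intro exI conjI)
      show "pseudo_prefix \<Delta> (Suc (Suc n)) = morse (s @ drop k s)"
        using pseudo_prefix_Suc_overlap[OF i] unfolding k s(1) drop_morse morse_append .
    qed (use s d ks in \<open>auto simp: successively_append_iff\<close>)
  next
    case False
    then have none: "\<Delta> i \<noteq> \<Delta> (Suc n)" if "i < Suc n" for i
      using last_index_exists[OF that, of \<Delta> "\<Delta> (Suc n)"] by blast
    then have "\<Delta> (Suc n)" using assms by blast
    show ?thesis
    proof (intro exI conjI)
      show "pseudo_prefix \<Delta> (Suc (Suc n)) = morse (s @ [True] @ s)"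
        using pseudo_prefix_Suc_no_overlap[of "Suc n" \<Delta>] none \<open>\<Delta> (Suc n)\<close> s(1) by (simp add: morse_append)
    qed (use s in \<open>auto simp: successively_append_iff successively_Cons\<close>)
  qed
qed

text \<open>The antipalindrome \<open>w\<^sub>j\<close> begins with 01, hence ends with 01, and
  \<open>\<Delta> j\<close> follows it.\<close>

lemma sublist_pseudo_prefix_letter:
  assumes "\<not> \<Delta> 0" "0 < j" "j < n"
  shows "sublist [False, True, \<Delta> j] (pseudo_prefix \<Delta> n)"
proof -
  let ?w = "pseudo_prefix \<Delta> j"
  obtain t where t: "?w = [False, True] @ t"
    using pseudo_prefix_mono[of "Suc 0" j \<Delta>] assms(1,2) unfolding pseudo_prefix_1
    by (auto simp: prefix_def)
  have "?w = exchange ?w" using antipalindrome_pseudo_prefix[of \<Delta> j] by (simp add: antipalindrome_def)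
  also have "\<dots> = exchange t @ [False, True]"
    unfolding t exchange_append by (simp add: exchange_def)
  finally have "?w @ [\<Delta> j] = exchange t @ [False, True, \<Delta> j]" by simp
  then have "sublist [False, True, \<Delta> j] (?w @ [\<Delta> j])" by (metis sublist_append_leftI)
  then show ?thesis
    using prefix_imp_sublist[OF prefix_pseudo_prefix_letter[OF assms(3), of \<Delta>]]
      sublist_order.order.trans by blast
qed

text \<open>The indices \<open>i\<close> and \<open>j\<close> provide the factors 011 and 010; the
  exchange antimorphism then yields 00 and 101.\<close>

lemma pseudo_prefix_attractor_card_ge_3:
  assumes "\<not> \<Delta> 0" "0 < i" "i < n" "\<Delta> i" "0 < j" "j < n" "\<not> \<Delta> j"
    and att: "attractor G (pseudo_prefix \<Delta> n)"
  shows "3 \<le> card G"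
proof -
  let ?w = "pseudo_prefix \<Delta> n"
  have ap: "antipalindrome ?w" by (rule antipalindrome_pseudo_prefix)
  have o: "sublist [False, True, True] ?w" "sublist [False, True, False] ?w"
    using sublist_pseudo_prefix_letter[of \<Delta>] assms by metis+
  have o2: "sublist [True, True] ?w"
    using sublist_order.order.trans[OF sublist_append_leftI[of "[True, True]" "[False]"]] o(1) by simp
  have e: "sublist [True, False, True] ?w" "sublist [False, False] ?w"
    using sublist_exchange[OF ap o(2)] sublist_exchange[OF ap o2] by (simp_all add: exchange_def)
  obtain m where "n = Suc m" using assms(3) by (cases n) auto
  then show ?thesis
    using pseudo_prefix_morse[of \<Delta> m] assms(1) morse_avoids attractor_card_ge_3[OF att o(2) e(1) o2 e(2)]
    by auto
qed

text \<open>Every closure after \<open>w\<^sub>2 = 011001\<close> shifts by 4, so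
  \<open>{1, 3}\<close> persists. The length equation is carried along because it determines the
  next shift.\<close>

lemma pseudo_prefix_ones:
  assumes "\<not> \<Delta> 0" "\<And>i. 0 < i \<Longrightarrow> i < n \<Longrightarrow> \<Delta> i" "2 \<le> n"
  shows "length (pseudo_prefix \<Delta> n) = length (pseudo_prefix \<Delta> (n - 1)) + 4 \<and>
    attractor {1, 3} (pseudo_prefix \<Delta> n)"
  using assms(3,2)
proof (induction n rule: nat_induct_at_least)
  case base
  have w1: "pseudo_prefix \<Delta> (Suc 0) = [False, True]" using pseudo_prefix_1[of \<Delta>] assms(1) by simp
  have w2: "pseudo_prefix \<Delta> 2 = [False, True, True, False, False, True]"
    using pseudo_prefix_Suc_no_overlap[of 1 \<Delta>] base assms(1) by (simp add: w1 numeral_2_eq_2)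
  have "\<exists>k\<in>{1, 3}. covers (pseudo_prefix \<Delta> 2) x k" if "sublist x (pseudo_prefix \<Delta> 2)" "x \<noteq> []" for x
  proof -
    \<comment> \<open>Position 3 cuts 011001 into 011 and 01, both factors of 011; there only single
      letters can miss position 1.\<close>
    have "x = [True] \<or> x = [False] \<or> ?thesis" if sub: "sublist x [False, True, True]"
    proof -
      have "1 < length [False, True, True]" by simp
      with sub show ?thesis
      proof (cases rule: sublist_cases_position)
        case 1
        then have "covers (pseudo_prefix \<Delta> 2) x 1"
          using covers_append_right[of "[False, True, True]" x 1 "[False, False, True]"] w2 by simp
        then show ?thesis by blast
      qed (use \<open>x \<noteq> []\<close> in \<open>auto simp: sublist_Cons_right prefix_Cons\<close>)
    qed
    moreover have "covers (pseudo_prefix \<Delta> 2) [False] 3" "covers (pseudo_prefix \<Delta> 2) [True] 1"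
      using covers_singleton[of 3 "pseudo_prefix \<Delta> 2"] covers_singleton[of 1 "pseudo_prefix \<Delta> 2"]
      by (simp_all add: w2)
    ultimately have *: ?thesis if "sublist x [False, True, True]" using that by auto
    have "3 < length (pseudo_prefix \<Delta> 2)" by (simp add: w2)
    with \<open>sublist x (pseudo_prefix \<Delta> 2)\<close> show ?thesis
    proof (cases rule: sublist_cases_position)
      case 1
      then show ?thesis by blast
    next
      case 2
      then show ?thesis using * by (simp add: w2 numeral_3_eq_3)
    next
      case 3
      then have "sublist x [False, True]" by (simp add: w2 numeral_3_eq_3)
      then have "sublist x [False, True, True]"
        using sublist_append_rightI[of "[False, True]" "[True]"] sublist_order.order.trans by fastforce
      then show ?thesis by (rule *)
    qed
  qed
  then show ?case unfolding attractor_iff_covers by (simp add: w1 w2)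
next
  case (Suc n)
  let ?w = "pseudo_prefix \<Delta> n"
  have "last_index \<Delta> (\<Delta> n) n (n - 1)"
    using Suc.prems Suc.hyps by (auto simp: last_index_def)
  then obtain y z where yz: "pseudo_prefix \<Delta> (Suc n) = ?w @ z" "pseudo_prefix \<Delta> (Suc n) = y @ ?w"
    "length (pseudo_prefix \<Delta> (n - 1)) + length y = length ?w"
    by (rule pseudo_prefix_Suc_period)
  have IH: "length ?w = length (pseudo_prefix \<Delta> (n - 1)) + 4" "attractor {1, 3} ?w"
    using Suc by auto
  have "length y = 4" using IH(1) yz(3) by simp
  \<comment> \<open>The shift 4 equals \<open>Suc 3\<close>, the largest shift that position 3
    allows.\<close>
  then show ?case using attractor_overlap[OF IH(2) yz(1,2), of 3] yz(2) by simp
qed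

section \<open>Directive sequences without and with a letter 1 among the first \<open>n\<close>
  letters\<close>

theorem theorem8:
  fixes \<Delta> u :: "nat \<Rightarrow> bool" and v :: "bool list" and \<Gamma> :: "nat set"
  assumes "\<Delta> 0 = False"
    and "u = pseudostandard \<Delta>"
    and "v \<noteq> []" and "antipalindrome v" and "starts_with u v"
    and "\<Gamma> = {ext_length v False, ext_length v True, length v - ext_length v True - 1}"
  shows "attractor \<Gamma> v \<and>
    (\<forall>n\<ge>2. v = pseudo_prefix \<Delta> n \<longrightarrow>
      (card \<Gamma> = 2 \<longleftrightarrow> starts_with \<Delta> (replicate n False)) \<and>
      (min_attractor \<Gamma> v \<longleftrightarrow> \<not> starts_with \<Delta> (False # replicate (n - 1) True)))"
proof -
  let ?w = "pseudo_prefix \<Delta>"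
  have \<Delta>0: "\<not> \<Delta> 0" using assms(1) by simp
  obtain n where v: "v = ?w n"
    using antipalindrome_prefix_pseudostandard assms(2,4,5) by metis
  have n: "0 < n" using assms(3) v by (cases n) auto
  \<comment> \<open>The statement quantifies over every index that represents \<open>v\<close>;
    strictly increasing lengths leave only this one.\<close>
  have n_unique: "m = n" if "v = ?w m" for m
    using that v length_pseudo_prefix_less[of m n \<Delta>] length_pseudo_prefix_less[of n m \<Delta>]
    by (metis less_irrefl linorder_neqE_nat)
  have letters: "True \<in> set v" "False \<in> set v"
    using pseudo_prefix_mono[of "Suc 0" n \<Delta>] n \<Delta>0 v unfolding pseudo_prefix_1
    by (auto simp: prefix_def)
  show ?thesis
  proof (cases "\<exists>i<n. \<Delta> i")
    case False
    then have zero: "\<And>i. i < n \<Longrightarrow> \<not> \<Delta> i" by blast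
    obtain m where m: "n = Suc m" using n by (cases n) auto
    have last: "last_index \<Delta> (\<not> True) n m" using zero m by (auto simp: last_index_def)
    have len: "length (?w m) = 2 * m" "length v = 2 * n"
      using zero m v by (simp_all add: length_pseudo_prefix_zeros)
    have "ext_length v False = 2 * m" "ext_length v True = 2 * m"
      using ext_length_pseudo_prefix[of \<Delta> False n m] ext_length_pseudo_prefix_none[of n \<Delta> True m]
        last zero len v by simp_all
    \<comment> \<open>Here \<open>e\<^sub>1\<close> takes the default value
      \<open>e\<^sub>0 = 2 * m\<close>, whose mirror image is 1; that position carries the letter
      1.\<close>
    then have \<Gamma>: "\<Gamma> = {2 * m, 1}" using assms(6) len m by simp
    have att: "attractor \<Gamma> v"
      unfolding attractor_iff_covers
    proof (intro conjI allI impI)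
      show "\<Gamma> \<subseteq> {..<length v}" using \<Gamma> len m by simp
      fix x assume x: "sublist x v \<and> x \<noteq> []"
      have "v ! 1" using pseudo_prefix_nth_1[OF n, of \<Delta>] \<Delta>0 v by simp
      then have "covers v [True] 1" using covers_singleton[of 1 v] len m by simp
      moreover have "covers v x (2 * m) \<or> x = [True]"
        using covers_pseudo_prefix_zeros[of m \<Delta> x] zero x v m by blast
      ultimately show "\<exists>k\<in>\<Gamma>. covers v x k" using \<Gamma> by blast
    qed
    have "card \<Gamma> = 2" if "2 \<le> n" using \<Gamma> m that by simp
    moreover have "min_attractor \<Gamma> v" if "2 \<le> n"
      using att attractor_card_ge_2 letters \<open>2 \<le> n \<Longrightarrow> card \<Gamma> = 2\<close>[OF that]
      unfolding min_attractor_def by metis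
    moreover have "starts_with \<Delta> (replicate n False)"
      using zero by (simp add: starts_with_iff)
    moreover have "\<not> starts_with \<Delta> (False # replicate (n - 1) True)" if "2 \<le> n"
    proof
      assume "starts_with \<Delta> (False # replicate (n - 1) True)"
      then have "\<Delta> 1 = (False # replicate (n - 1) True) ! 1"
        using that unfolding starts_with_iff by fastforce
      then show False using zero[of 1] that by simp
    qed
    ultimately show ?thesis using att n_unique by blast
  next
    case True
    then obtain j where j: "last_index \<Delta> True n j" using last_index_exists by metis
    obtain i where i: "last_index \<Delta> False n i" using last_index_exists[of 0 n \<Delta> False] n \<Delta>0 by metis
    have e: "ext_length v False = length (?w i)" "ext_length v True = length (?w j)"
      using ext_length_pseudo_prefix i j v by blast+
    have ij: "i < n" "j < n" "\<not> \<Delta> i" "\<Delta> j" using i j by (simp_all add: last_index_def)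
    then have less: "length (?w i) < length v" "length (?w j) < length v"
      using v by (simp_all add: length_pseudo_prefix_less)
    have even: "even (length (?w k))" for k
      by (rule even_length_antipalindrome[OF antipalindrome_pseudo_prefix])
    have \<Gamma>: "\<Gamma> = {length (?w i), length (?w j), length v - length (?w j) - 1}"
      using assms(6) e by simp
    have att: "attractor \<Gamma> v"
      unfolding attractor_iff_covers
    proof (intro conjI allI impI)
      show "\<Gamma> \<subseteq> {..<length v}" using \<Gamma> less by auto
      show "\<exists>k\<in>\<Gamma>. covers v x k" if "sublist x v \<and> x \<noteq> []" for x
        using covers_pseudo_prefix[OF \<Delta>0 i j, of x] that v \<Gamma> by blast
    qed
    have "i \<noteq> j" using ij by blast
    then have ij': "length (?w i) \<noteq> length (?w j)"
      using length_pseudo_prefix_less[of i j \<Delta>] length_pseudo_prefix_less[of j i \<Delta>]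
      by (metis less_irrefl linorder_neqE_nat)
    \<comment> \<open>Parity separates the mirror position from \<open>e\<^sub>0\<close> and
      \<open>e\<^sub>1\<close>, which are lengths of antipalindromes.\<close>
    have "odd (length v - length (?w j) - 1)"
      using even[of n] even[of j] less(2) v by simp
    then have "length v - length (?w j) - 1 \<noteq> length (?w k)" for k
      using even[of k] by metis
    moreover note ij'
    moreover have "card {a, b, c} = 3" if "a \<noteq> b" "c \<noteq> a" "c \<noteq> b" for a b c :: nat
      using that by auto
    ultimately have card: "card \<Gamma> = 3" unfolding \<Gamma> by blast
    have not_zeros: "\<not> starts_with \<Delta> (replicate n False)"
      using ij by (auto simp: starts_with_iff)
    have "min_attractor \<Gamma> v \<longleftrightarrow> \<not> starts_with \<Delta> (False # replicate (n - 1) True)" if "2 \<le> n"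
    proof (cases "starts_with \<Delta> (False # replicate (n - 1) True)")
      case True
      then have ones: "\<Delta> k = (False # replicate (n - 1) True) ! k" if "k < n" for k
        using that n unfolding starts_with_iff by simp
      have "\<Delta> k" if "0 < k" "k < n" for k
        using ones[OF that(2)] that by (simp add: nth_Cons')
      then have "attractor {1, 3} v" using pseudo_prefix_ones[of \<Delta> n] \<Delta>0 \<open>2 \<le> n\<close> v by blast
      moreover have "card {1, 3 :: nat} < card \<Gamma>" using card by simp
      ultimately show ?thesis using True unfolding min_attractor_def by (meson not_less)
    next
      case False
      \<comment> \<open>Any deviation from \<open>01^(n-1)\<close> is a 0 at a positive index;
        together with the 1 at index \<open>j\<close> it gives the lower bound 3.\<close>
      then obtain k where "k < n" "\<Delta> k \<noteq> (False # replicate (n - 1) True) ! k"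
        using n by (auto simp: starts_with_iff)
      then have k: "0 < k" "k < n" "\<not> \<Delta> k"
        using \<Delta>0 by (auto simp: nth_Cons' split: if_splits)
      have "0 < j" using ij(4) \<Delta>0 by (metis gr0I)
      then have "3 \<le> card G" if "attractor G v" for G
        using pseudo_prefix_attractor_card_ge_3[of \<Delta> j n k G] \<Delta>0 ij(2,4) k that v by blast
      then show ?thesis using False att card unfolding min_attractor_def by simp
    qed
    then show ?thesis using att n_unique card not_zeros by auto
  qed
qed

end
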